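(* Let $d,m\ge1$ be integers, let $\mathbf N=(N_1,\dots,N_d)$ be a tuple of positive integers, let $\Phi_0,\Phi_1$ be power spectral densities of $\mathbb R^m$-valued stationary $\mathbf N$-periodic random fields with $\Phi_0(\boldsymbol\zeta_{\boldsymbol\ell})>0$ and $\Phi_1(\boldsymbol\zeta_{\boldsymbol\ell})>0$ for all $\boldsymbol\ell\in\mathbb Z^d_{\mathbf N}$, and let $\Omega(\boldsymbol\zeta_{\boldsymbol\ell})=H(\boldsymbol\zeta_{\boldsymbol\ell})H(\boldsymbol\zeta_{\boldsymbol\ell})^*$ be a weight function with $\Omega(\boldsymbol\zeta_{\boldsymbol\ell})>0$ for all $\boldsymbol\ell\in\mathbb Z^d_{\mathbf N}$, where $H(\boldsymbol\zeta_{\boldsymbol\ell})=\sum_{\mathbf t\in\mathbb Z^d_{\mathbf N}}H_{\mathbf t}\boldsymbol\zeta_{\boldsymbol\ell}^{-\mathbf t}$ with $H_{\mathbf t}\in\mathbb R^{m\times m}$. Define, at each $\boldsymbol\zeta_{\boldsymbol\ell}$, $$U_\Omega=\Phi_1^{-1/2}\,\Omega^{-1}\,\Phi_0^{-1/2}\big(\Phi_0^{1/2}\,\Omega\,\Phi_1\,\Omega\,\Phi_0^{1/2}\big)^{1/2}.$$ Then $U_\Omega$ is all-pass, i.e. $U_\Omega(\boldsymbol\zeta_{\boldsymbol\ell})U_\Omega(\boldsymbol\zeta_{\boldsymbol\ell})^*=I$ for every $\boldsymbol\ell\in\mathbb Z^d_{\mathbf N}$, and the path $$\Phi_\tau(\boldsymbol\zeta_{\boldsymbol\ell})=\big[(1-\tau)\Phi_0(\boldsymbol\zeta_{\boldsymbol\ell})^{1/2}+\tau\,\Phi_1(\boldsymbol\zeta_{\boldsymbol\ell})^{1/2}U_\Omega(\boldsymbol\zeta_{\boldsymbol\ell})\big]\big[(1-\tau)\Phi_0(\boldsymbol\zeta_{\boldsymbol\ell})^{1/2}+\tau\,\Phi_1(\boldsymbol\zeta_{\boldsymbol\ell})^{1/2}U_\Omega(\boldsymbol\zeta_{\boldsymbol\ell})\big]^*,\qquad\tau\in[0,1],$$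 is a geodesic connecting $\Phi_0$ and $\Phi_1$, with respect to the weighted Hellinger distance $d_\Omega$, on the set of positive definite power spectral densities of $\mathbb R^m$-valued stationary $\mathbf N$-periodic random fields.
   Context: Notation: $\mathbb Z^d_{\mathbf N}=\{\mathbf t\in\mathbb Z^d:\ 0\le t_l\le N_l-1,\ l=1,\dots,d\}$; $|\mathbf N|=\prod_{l=1}^dN_l$; $j$ is the imaginary unit; for $\boldsymbol\ell\in\mathbb Z^d_{\mathbf N}$, $\boldsymbol\zeta_{\boldsymbol\ell}=(\zeta_{\ell_1},\dots,\zeta_{\ell_d})$ with $\zeta_{\ell_i}=e^{j\frac{2\pi}{N_i}\ell_i}$ and $\boldsymbol\zeta_{\boldsymbol\ell}^{-\mathbf t}=\prod_{i=1}^d\zeta_{\ell_i}^{-t_i}$; $A^*$ is the conjugate transpose; $A>0$ means Hermitian positive definite; $A^{1/2}$ is the Hermitian positive semidefinite square root. A positive definite power spectral density of an $\mathbb R^m$-valued stationary $\mathbf N$-periodic field is a function $\Phi(\boldsymbol\zeta_{\boldsymbol\ell})=\sum_{\mathbf t\in\mathbb Z^d_{\mathbf N}}R_{\mathbf t}\boldsymbol\zeta_{\boldsymbol\ell}^{-\mathbf t}$, $\boldsymbol\ell\in\mathbb Z^d_{\mathbf N}$, with $R_{\mathbf t}\in\mathbb R^{m\times m}$, such that $\Phi(\boldsymbol\zeta_{\boldsymbol\ell})$ is Hermitian positive definite for all $\boldsymbol\ell\in\mathbb Z^d_{\mathbf N}$ (here $R_{\mathbf t}$ is the covariance field of the random field).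 For two such densities $\Phi,\Psi$ the weighted Hellinger distance with weight $\Omega$ is the nonnegative number $d_\Omega(\Phi,\Psi)$ with $$d_\Omega(\Phi,\Psi)^2=\frac1{|\mathbf N|}\operatorname{tr}\sum_{\boldsymbol\ell\in\mathbb Z^d_{\mathbf N}}\Big(\Omega\Phi+\Omega\Psi-2\big(\Psi^{1/2}\,\Omega\,\Phi\,\Omega\,\Psi^{1/2}\big)^{1/2}\Big)(\boldsymbol\zeta_{\boldsymbol\ell}).$$ A path $(\Phi_\tau)_{\tau\in[0,1]}$ is a geodesic for $d_\Omega$ connecting $\Phi_0$ and $\Phi_1$ if it stays in the given set of densities, has these endpoints, and $d_\Omega(\Phi_\sigma,\Phi_\tau)=|\sigma-\tau|\,d_\Omega(\Phi_0,\Phi_1)$ for all $\sigma,\tau\in[0,1]$. *)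

theory Defs
  imports "HOL-Analysis.Analysis"
begin

definition grid :: "nat ^ 'd \<Rightarrow> (int ^ 'd) set" where
  "grid N = {t. \<forall>l. 0 \<le> t $ l \<and> t $ l \<le> int (N $ l) - 1}"

definition zeta :: "nat ^ 'd \<Rightarrow> int ^ 'd \<Rightarrow> complex ^ 'd" where
  "zeta N l = (\<chi> i. exp (\<i> * of_real (2 * pi / real (N $ i) * of_int (l $ i))))"

definition zmonom :: "complex ^ 'd \<Rightarrow> int ^ 'd \<Rightarrow> complex" where
  "zmonom z t = (\<Prod>i\<in>UNIV. (z $ i) powi (t $ i))"

text \<open>The matrix-valued sum of \<open>C t * z\<^sup>-\<^sup>t\<close> over the grid, written entrywise; the
  coefficients are real matrices.\<close>

definition trig_matrix ::
    "nat ^ 'd \<Rightarrow> (int ^ 'd \<Rightarrow> real ^ 'm ^ 'm) \<Rightarrow> complex ^ 'd \<Rightarrow> complex ^ 'm ^ 'm" where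
  "trig_matrix N C z = (\<chi> a b. \<Sum>t\<in>grid N. of_real (C t $ a $ b) * zmonom z (- t))"

definition adj :: "complex ^ 'n ^ 'm \<Rightarrow> complex ^ 'm ^ 'n" where
  "adj A = map_matrix cnj (transpose A)"

text \<open>The inner product of \<open>complex ^ 'm\<close> in the library is real-valued: it is the real part of
  \<open>x\<^sup>* y\<close>. For Hermitian \<open>A\<close> the number \<open>x\<^sup>* A x\<close> is real, so nothing is lost below.\<close>

definition hpd :: "complex ^ 'm ^ 'm \<Rightarrow> bool" where
  "hpd A \<longleftrightarrow> adj A = A \<and> (\<forall>x. x \<noteq> 0 \<longrightarrow> 0 < x \<bullet> (A *v x))"

definition hpsd :: "complex ^ 'm ^ 'm \<Rightarrow> bool" where
  "hpsd A \<longleftrightarrow> adj A = A \<and> (\<forall>x. 0 \<le> x \<bullet> (A *v x))"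

text \<open>Meaningful for Hermitian positive semidefinite arguments only.\<close>

definition msqrt :: "complex ^ 'm ^ 'm \<Rightarrow> complex ^ 'm ^ 'm" where
  "msqrt A = (THE B. hpsd B \<and> B ** B = A)"

text \<open>Densities and weights are functions on the discrete torus \<open>zeta N ` grid N\<close>. They are
  rendered as total functions on \<open>complex ^ 'd\<close>, of which only the values on these points matter.\<close>

definition pd_spectral_density ::
    "nat ^ 'd \<Rightarrow> (complex ^ 'd \<Rightarrow> complex ^ 'm ^ 'm) \<Rightarrow> bool" where
  "pd_spectral_density N \<Phi> \<longleftrightarrow>
     (\<exists>R :: int ^ 'd \<Rightarrow> real ^ 'm ^ 'm. \<forall>l\<in>grid N. \<Phi> (zeta N l) = trig_matrix N R (zeta N l)) \<and>
     (\<forall>l\<in>grid N. hpd (\<Phi> (zeta N l)))"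

definition all_pass :: "nat ^ 'd \<Rightarrow> (complex ^ 'd \<Rightarrow> complex ^ 'm ^ 'm) \<Rightarrow> bool" where
  "all_pass N U \<longleftrightarrow> (\<forall>l\<in>grid N. U (zeta N l) ** adj (U (zeta N l)) = mat 1)"

definition hellinger ::
    "nat ^ 'd \<Rightarrow> (complex ^ 'd \<Rightarrow> complex ^ 'm ^ 'm) \<Rightarrow>
     (complex ^ 'd \<Rightarrow> complex ^ 'm ^ 'm) \<Rightarrow> (complex ^ 'd \<Rightarrow> complex ^ 'm ^ 'm) \<Rightarrow> real" where
  "hellinger N \<Omega> \<Phi> \<Psi> = (THE \<delta>. 0 \<le> \<delta> \<and>
     complex_of_real (\<delta>\<^sup>2) = 1 / of_nat (\<Prod>i\<in>UNIV. N $ i) *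
       trace (\<Sum>l\<in>grid N. let z = zeta N l in
         \<Omega> z ** \<Phi> z + \<Omega> z ** \<Psi> z
         - 2 *\<^sub>R msqrt (msqrt (\<Psi> z) ** \<Omega> z ** \<Phi> z ** \<Omega> z ** msqrt (\<Psi> z))))"

definition hellinger_geodesic ::
    "nat ^ 'd \<Rightarrow> (complex ^ 'd \<Rightarrow> complex ^ 'm ^ 'm) \<Rightarrow>
     (complex ^ 'd \<Rightarrow> complex ^ 'm ^ 'm) \<Rightarrow> (complex ^ 'd \<Rightarrow> complex ^ 'm ^ 'm) \<Rightarrow>
     (real \<Rightarrow> complex ^ 'd \<Rightarrow> complex ^ 'm ^ 'm) \<Rightarrow> bool" where
  "hellinger_geodesic N \<Omega> \<Phi>\<^sub>0 \<Phi>\<^sub>1 P \<longleftrightarrow>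
     (\<forall>\<tau>\<in>{0..1}. pd_spectral_density N (P \<tau>)) \<and>
     (\<forall>l\<in>grid N. P 0 (zeta N l) = \<Phi>\<^sub>0 (zeta N l) \<and> P 1 (zeta N l) = \<Phi>\<^sub>1 (zeta N l)) \<and>
     (\<forall>\<sigma>\<in>{0..1}. \<forall>\<tau>\<in>{0..1}.
        hellinger N \<Omega> (P \<sigma>) (P \<tau>) = \<bar>\<sigma> - \<tau>\<bar> * hellinger N \<Omega> \<Phi>\<^sub>0 \<Phi>\<^sub>1)"

definition U_weight ::
    "(complex ^ 'd \<Rightarrow> complex ^ 'm ^ 'm) \<Rightarrow> (complex ^ 'd \<Rightarrow> complex ^ 'm ^ 'm) \<Rightarrow>
     (complex ^ 'd \<Rightarrow> complex ^ 'm ^ 'm) \<Rightarrow> complex ^ 'd \<Rightarrow> complex ^ 'm ^ 'm" where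
  "U_weight \<Omega> \<Phi>\<^sub>0 \<Phi>\<^sub>1 z =
     matrix_inv (msqrt (\<Phi>\<^sub>1 z)) ** matrix_inv (\<Omega> z) ** matrix_inv (msqrt (\<Phi>\<^sub>0 z)) **
     msqrt (msqrt (\<Phi>\<^sub>0 z) ** \<Omega> z ** \<Phi>\<^sub>1 z ** \<Omega> z ** msqrt (\<Phi>\<^sub>0 z))"

definition hellinger_path ::
    "(complex ^ 'd \<Rightarrow> complex ^ 'm ^ 'm) \<Rightarrow> (complex ^ 'd \<Rightarrow> complex ^ 'm ^ 'm) \<Rightarrow>
     (complex ^ 'd \<Rightarrow> complex ^ 'm ^ 'm) \<Rightarrow> real \<Rightarrow> complex ^ 'd \<Rightarrow> complex ^ 'm ^ 'm" where
  "hellinger_path \<Omega> \<Phi>\<^sub>0 \<Phi>\<^sub>1 \<tau> z =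
     (let W = (1 - \<tau>) *\<^sub>R msqrt (\<Phi>\<^sub>0 z) + \<tau> *\<^sub>R (msqrt (\<Phi>\<^sub>1 z) ** U_weight \<Omega> \<Phi>\<^sub>0 \<Phi>\<^sub>1 z)
      in W ** adj W)"

end

theory Submission
  imports Defs
begin

text \<open>A density factors as \<open>\<Phi> = X X\<^sup>*\<close>, and \<open>d\<^sub>\<Omega>(X X\<^sup>*, Y Y\<^sup>*)\<^sup>2\<close> is the average over the torus of
  \<open>tr ((X - Y)\<^sup>* \<Omega> (X - Y))\<close> whenever \<open>Y\<^sup>* \<Omega> X\<close> is positive semidefinite. For \<open>X\<^sub>0 = \<Phi>\<^sub>0\<^sup>1\<^sup>/\<^sup>2\<close> and
  \<open>X\<^sub>1 = \<Phi>\<^sub>1\<^sup>1\<^sup>/\<^sup>2 U\<^sub>\<Omega>\<close> the matrix \<open>X\<^sub>0\<^sup>* \<Omega> X\<^sub>1 = (\<Phi>\<^sub>0\<^sup>1\<^sup>/\<^sup>2 \<Omega> \<Phi>\<^sub>1 \<Omega> \<Phi>\<^sub>0\<^sup>1\<^sup>/\<^sup>2)\<^sup>1\<^sup>/\<^sup>2\<close> is positive, hence so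
  is \<open>X\<^sub>\<tau>\<^sup>* \<Omega> X\<^sub>\<sigma>\<close> for all points of the segment \<open>X\<^sub>\<tau> = (1 - \<tau>) X\<^sub>0 + \<tau> X\<^sub>1\<close>. As
  \<open>X\<^sub>\<sigma> - X\<^sub>\<tau> = (\<sigma> - \<tau>) (X\<^sub>1 - X\<^sub>0)\<close>, the distance scales linearly. The path consists of spectral
  densities because a function on the torus has real Fourier coefficients if and only if
  \<open>\<Phi>(\<zeta>\<^sup>-\<^sup>1)\<close> is the entrywise conjugate of \<open>\<Phi>(\<zeta>)\<close>, and square roots and inverses commute with
  entrywise conjugation.\<close>

section \<open>Square roots of positive self-adjoint maps\<close>

text \<open>The first variation of the quadratic form at \<open>v\<close> vanishes along every
  direction of \<open>S\<close> orthogonal to \<open>v\<close>. So \<open>f v\<close> is orthogonal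
  to all these directions, among them its own residual \<open>f v - c *\<^sub>R v\<close>.\<close>

lemma selfadjoint_maximizer_eigenvector:
  fixes f :: "'a::euclidean_space \<Rightarrow> 'a"
  assumes f: "linear f" and sym: "\<And>x y. f x \<bullet> y = x \<bullet> f y"
    and S: "subspace S" and inv: "f ` S \<subseteq> S"
    and v: "v \<in> S" "norm v = 1"
    and max: "\<And>x. x \<in> S \<Longrightarrow> norm x = 1 \<Longrightarrow> x \<bullet> f x \<le> v \<bullet> f v"
  shows "f v = (v \<bullet> f v) *\<^sub>R v"
proof -
  define c where "c = v \<bullet> f v"
  have vv: "v \<bullet> v = 1"
    using v by (simp add: norm_eq_1)
  have bound: "x \<bullet> f x \<le> c * (x \<bullet> x)" if "x \<in> S" for x
  proof (cases "x = 0")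
    case False
    have "x /\<^sub>R norm x \<in> S"
      using S that by (simp add: subspace_scale)
    from max[OF this] have "(x /\<^sub>R norm x) \<bullet> f (x /\<^sub>R norm x) \<le> c"
      using False by (simp add: c_def)
    then have "(x \<bullet> f x) / (norm x)\<^sup>2 \<le> c"
      by (simp add: linear_cmul[OF f] power2_eq_square divide_inverse mult_ac)
    then show ?thesis
      using False by (simp add: divide_le_eq power2_norm_eq_inner mult.commute)
  qed (simp add: linear_0[OF f])
  have ortho: "f v \<bullet> w = 0" if w: "w \<in> S" "v \<bullet> w = 0" for w
  proof -
    define p q where "p = 2 * (f v \<bullet> w)" and "q = c * (w \<bullet> w) - w \<bullet> f w"
    \<comment> \<open>This is \<open>bound\<close> at \<open>v + t *\<^sub>R w\<close>: the constant
      terms cancel and the parts linear and quadratic in \<open>t\<close> remain.\<close>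
    have *: "t * p \<le> t\<^sup>2 * q" for t
    proof -
      have "v + t *\<^sub>R w \<in> S"
        using S v w by (simp add: subspace_add subspace_scale)
      from bound[OF this] show ?thesis
        using w vv sym[of v w] sym[of w v]
        by (simp add: linear_add[OF f] linear_cmul[OF f] inner_simps p_def q_def c_def
            power2_eq_square algebra_simps inner_commute)
    qed
    have q: "0 \<le> q"
      using bound[OF w(1)] by (simp add: q_def)
    \<comment> \<open>Inserting \<open>t = r\<close> gives
      \<open>r\<^sup>2 * (q + 1) \<le> r\<^sup>2 * q\<close>. The added one keeps the denominator
      positive when \<open>q = 0\<close>.\<close>
    define r where "r = p / (q + 1)"
    have pr: "p = r * (q + 1)"
      using q by (simp add: r_def)
    have "r\<^sup>2 \<le> 0"
      using *[of r] by (simp add: pr power2_eq_square algebra_simps)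
    then have "p = 0"
      by (simp add: pr)
    then show ?thesis
      by (simp add: p_def)
  qed
  define w where "w = f v - c *\<^sub>R v"
  have "w \<in> S"
    using S v inv by (auto simp: w_def subspace_diff subspace_scale)
  moreover have vw: "v \<bullet> w = 0"
    using vv by (simp add: w_def inner_simps c_def)
  ultimately have "f v \<bullet> w = 0"
    by (rule ortho)
  then have "w \<bullet> w = 0"
    using vw by (simp add: w_def inner_simps algebra_simps)
  then show ?thesis
    by (simp add: w_def c_def)
qed

text \<open>By compactness the quadratic form has a maximizer on the unit sphere of
  \<open>S\<close>, which is an eigenvector; by symmetry its orthogonal complement in
  \<open>S\<close> is again invariant. Allowing arbitrary invariant subspaces lets the induction on
  the dimension pass to that complement.\<close>

lemma selfadjoint_eigenbasis_subspace:
  fixes f :: "'a::euclidean_space \<Rightarrow> 'a"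
  assumes f: "linear f" and sym: "\<And>x y. f x \<bullet> y = x \<bullet> f y"
  shows "subspace S \<Longrightarrow> f ` S \<subseteq> S \<Longrightarrow>
    \<exists>B. finite B \<and> B \<subseteq> S \<and> span B = S \<and> pairwise orthogonal B \<and>
      (\<forall>b\<in>B. norm b = 1 \<and> f b = (b \<bullet> f b) *\<^sub>R b)"
proof (induction "dim S" arbitrary: S rule: less_induct)
  case less
  note S = less.prems(1) and inv = less.prems(2)
  show ?case
  proof (cases "S = {0}")
    case True
    then show ?thesis
      by (intro exI[of _ "{}"]) auto
  next
    case False
    then obtain u where "u \<in> S" "u \<noteq> 0"
      using S subspace_0 by blast
    then have "u /\<^sub>R norm u \<in> S \<inter> sphere 0 1"
      using S by (simp add: subspace_scale)
    then have "S \<inter> sphere 0 1 \<noteq> {}"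
      by blast
    moreover have "compact (S \<inter> sphere 0 1)"
      using S by (simp add: closed_Int_compact closed_subspace)
    moreover have "continuous_on (S \<inter> sphere 0 1) (\<lambda>x. x \<bullet> f x)"
      using f by (intro continuous_intros linear_continuous_on) (simp add: linear_conv_bounded_linear)
    ultimately obtain v where "v \<in> S \<inter> sphere 0 1"
        and "\<forall>x\<in>S \<inter> sphere 0 1. x \<bullet> f x \<le> v \<bullet> f v"
      using continuous_attains_sup by blast
    then have v: "v \<in> S" "norm v = 1"
        and max: "\<And>x. x \<in> S \<Longrightarrow> norm x = 1 \<Longrightarrow> x \<bullet> f x \<le> v \<bullet> f v"
      by simp_all
    have ev: "f v = (v \<bullet> f v) *\<^sub>R v"
      by (rule selfadjoint_maximizer_eigenvector[OF f sym S inv v max])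
    define T where "T = {x \<in> S. v \<bullet> x = 0}"
    have T: "subspace T"
      using S by (auto simp: T_def subspace_def inner_simps)
    have "v \<bullet> f x = 0" if "v \<bullet> x = 0" for x
      using sym[of v x] ev that by (metis inner_scaleR_left mult_zero_right)
    then have invT: "f ` T \<subseteq> T"
      using inv by (auto simp: T_def)
    have "v \<notin> T"
      using v by (auto simp: T_def norm_eq_1)
    moreover have "T \<subseteq> S"
      by (auto simp: T_def)
    ultimately have "T \<subset> S"
      using v(1) by blast
    then have "dim T < dim S"
      using S T by (metis dim_psubset span_eq_iff)
    from less.hyps[OF this T invT] obtain B where B: "finite B" "B \<subseteq> T" "span B = T"
      "pairwise orthogonal B" "\<forall>b\<in>B. norm b = 1 \<and> f b = (b \<bullet> f b) *\<^sub>R b"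
      by blast
    have "x \<in> span (insert v B)" if "x \<in> S" for x
    proof -
      have "x - (v \<bullet> x) *\<^sub>R v \<in> T"
        using that v S by (simp add: T_def subspace_diff subspace_scale inner_simps norm_eq_1)
      then show ?thesis
        using B(3) span_breakdown_eq by blast
    qed
    moreover have "span (insert v B) \<subseteq> S"
      using S v B(2) by (intro span_minimal) (auto simp: T_def)
    ultimately have "span (insert v B) = S"
      by blast
    moreover have "pairwise orthogonal (insert v B)"
      using B(2,4) by (auto simp: pairwise_insert T_def orthogonal_def inner_commute)
    ultimately show ?thesis
      using B v ev by (intro exI[of _ "insert v B"]) (auto simp: T_def)
  qed
qed

text \<open>In an orthonormal eigenbasis it suffices to replace each eigenvalue, which is
  \<open>b \<bullet> f b\<close> for a unit eigenvector \<open>b\<close>, by its root.\<close>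

lemma psd_map_sqrt_exists:
  fixes f :: "'a::euclidean_space \<Rightarrow> 'a"
  assumes f: "linear f" and sym: "\<And>x y. f x \<bullet> y = x \<bullet> f y" and psd: "\<And>x. 0 \<le> x \<bullet> f x"
  obtains g where "linear g" "\<And>x y. g x \<bullet> y = x \<bullet> g y" "\<And>x. 0 \<le> x \<bullet> g x" "g \<circ> g = f"
proof -
  obtain B where B: "finite B" "span B = UNIV" "pairwise orthogonal B"
      and ev: "\<And>b. b \<in> B \<Longrightarrow> norm b = 1 \<and> f b = (b \<bullet> f b) *\<^sub>R b"
    using selfadjoint_eigenbasis_subspace[OF f sym, of UNIV] by auto
  define g where "g = (\<lambda>x. \<Sum>b\<in>B. (sqrt (b \<bullet> f b) * (b \<bullet> x)) *\<^sub>R b)"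
  have g: "linear g"
    by (rule linearI)
      (auto simp: g_def inner_simps algebra_simps sum.distrib scaleR_sum_right)
  have gb: "g b = sqrt (b \<bullet> f b) *\<^sub>R b" if "b \<in> B" for b
  proof -
    have "(sqrt (c \<bullet> f c) * (c \<bullet> b)) *\<^sub>R c = (if c = b then sqrt (b \<bullet> f b) *\<^sub>R b else 0)"
      if "c \<in> B" for c
      using B(3) ev[OF \<open>b \<in> B\<close>] that \<open>b \<in> B\<close>
      by (auto simp: pairwise_def orthogonal_def norm_eq_1)
    then show ?thesis
      using B(1) that by (simp add: g_def)
  qed
  have "(g \<circ> g) b = f b" if "b \<in> B" for b
    using gb[OF that] ev[OF that] psd[of b]
    by (simp add: linear_cmul[OF g] flip: real_sqrt_mult power2_eq_square)
  then have gg: "g \<circ> g = f"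
    using linear_eq_on_span[OF linear_compose[OF g g] f] B(2) by blast
  show ?thesis
  proof (rule that)
    show "g x \<bullet> y = x \<bullet> g y" for x y
      by (simp add: g_def inner_sum_left inner_sum_right inner_commute mult_ac)
    have "x \<bullet> g x = (\<Sum>b\<in>B. sqrt (b \<bullet> f b) * (b \<bullet> x)\<^sup>2)" for x
      by (simp add: g_def inner_sum_right inner_commute power2_eq_square mult_ac)
    then show "0 \<le> x \<bullet> g x" for x
      by (auto intro!: sum_nonneg mult_nonneg_nonneg simp: psd)
  qed (fact g gg)+
qed

text \<open>If \<open>h b = c *\<^sub>R b\<close>, then \<open>g\<close> squared acts on
  \<open>b\<close> as \<open>c\<^sup>2\<close>, so \<open>y = g b - c *\<^sub>R b\<close> satisfies
  \<open>g y = - c *\<^sub>R y\<close>. For \<open>c > 0\<close> the positivity of \<open>g\<close>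
  forces \<open>y = 0\<close>.\<close>

lemma psd_map_sqrt_unique:
  fixes g h :: "'a::euclidean_space \<Rightarrow> 'a"
  assumes g: "linear g" "\<And>x y. g x \<bullet> y = x \<bullet> g y" "\<And>x. 0 \<le> x \<bullet> g x"
    and h: "linear h" "\<And>x y. h x \<bullet> y = x \<bullet> h y" "\<And>x. 0 \<le> x \<bullet> h x"
    and eq: "g \<circ> g = h \<circ> h"
  shows "g = h"
proof -
  obtain B where B: "span B = UNIV" and ev: "\<And>b. b \<in> B \<Longrightarrow> h b = (b \<bullet> h b) *\<^sub>R b"
    using selfadjoint_eigenbasis_subspace[OF h(1,2), of UNIV] by auto
  have "g b = h b" if "b \<in> B" for b
  proof -
    define c where "c = b \<bullet> h b"
    have c: "0 \<le> c" and hb: "h b = c *\<^sub>R b"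
      using h(3) ev[OF that] by (simp_all add: c_def)
    define y where "y = g b - c *\<^sub>R b"
    have "g (g b) = c *\<^sub>R c *\<^sub>R b"
      using fun_cong[OF eq, of b] hb by (simp add: linear_cmul[OF h(1)])
    then have gy: "g y = - c *\<^sub>R y"
      by (simp add: y_def linear_diff[OF g(1)] linear_cmul[OF g(1)] algebra_simps)
    have "y = 0"
    proof (cases "c = 0")
      \<comment> \<open>Here \<open>y = g b\<close> and \<open>g y = 0\<close>; symmetry moves one
        factor \<open>g\<close> across the inner product.\<close>
      case True
      then have "y \<bullet> y = b \<bullet> g y"
        by (simp add: y_def g(2))
      then show ?thesis
        using gy True by simp
    next
      case False
      then have "y \<bullet> y \<le> 0"
        using g(3)[of y] gy c by (simp add: mult_le_0_iff)
      then show ?thesis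
        using inner_gt_zero_iff[of y] by linarith
    qed
    then show ?thesis
      by (simp add: y_def hb)
  qed
  then show ?thesis
    using linear_eq_on_span[OF g(1) h(1)] B by blast
qed

section \<open>Hermitian positive matrices\<close>

lemma adj_nth [simp]: "adj A $ i $ j = cnj (A $ j $ i)"
  by (simp add: adj_def transpose_def)

lemma adj_adj [simp]: "adj (adj A) = A"
  by (simp add: vec_eq_iff)

lemma adj_mult: "adj (A ** B) = adj B ** adj A"
  by (simp add: vec_eq_iff matrix_matrix_mult_def mult.commute)

lemma adj_add: "adj (A + B) = adj A + adj B"
  by (simp add: vec_eq_iff)

lemma adj_scaleR: "adj (c *\<^sub>R A) = c *\<^sub>R adj A"
  by (simp add: vec_eq_iff)

lemma adj_mat_1 [simp]: "adj (mat 1) = mat 1"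
  by (simp add: vec_eq_iff mat_def)

lemma scaleR_matrix_mult_left: "(c *\<^sub>R A) ** B = c *\<^sub>R (A ** (B :: complex ^ 'n ^ 'm))"
  by (simp add: vec_eq_iff matrix_matrix_mult_def scaleR_sum_right)

lemma scaleR_matrix_mult_right: "A ** (c *\<^sub>R B) = c *\<^sub>R (A ** (B :: complex ^ 'n ^ 'm))"
  by (simp add: vec_eq_iff matrix_matrix_mult_def scaleR_sum_right)

lemma scaleR_matrix_vector: "(c *\<^sub>R A) *v x = c *\<^sub>R (A *v (x :: complex ^ 'n))"
  by (simp add: vec_eq_iff matrix_vector_mult_def scaleR_sum_right)

lemma inner_vec_complex: "(x :: complex ^ 'n) \<bullet> y = Re (\<Sum>i\<in>UNIV. cnj (x $ i) * y $ i)"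
  by (simp add: inner_vec_def inner_complex_def)

lemma inner_adj: "(adj A *v x) \<bullet> y = x \<bullet> (A *v y)"
proof -
  have "(\<Sum>j\<in>UNIV. cnj (\<Sum>i\<in>UNIV. cnj (A $ i $ j) * x $ i) * y $ j)
      = (\<Sum>i\<in>UNIV. cnj (x $ i) * (\<Sum>j\<in>UNIV. A $ i $ j * y $ j))"
    by (simp add: sum_distrib_left sum_distrib_right mult_ac, subst sum.swap) (simp add: mult_ac)
  then show ?thesis
    by (simp add: inner_vec_complex matrix_vector_mult_def)
qed

lemma inner_adj': "x \<bullet> (adj A *v y) = (A *v x) \<bullet> y"
  using inner_adj[of "adj A" x y] by simp

text \<open>A vector is determined by its real inner products with all \<open>y\<close>, so passing
  to real parts loses nothing. Hermitian matrices thus become symmetric real-linear maps, to which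
  the preceding spectral theory applies.\<close>

lemma adj_eq_self_iff: "adj A = A \<longleftrightarrow> (\<forall>x y. (A *v x) \<bullet> y = x \<bullet> (A *v y))"
proof
  assume "\<forall>x y. (A *v x) \<bullet> y = x \<bullet> (A *v y)"
  then have "(adj A *v x) \<bullet> y = (A *v x) \<bullet> y" for x y
    by (simp add: inner_adj)
  then show "adj A = A"
    by (metis matrix_eq vector_eq_rdot)
qed (simp add: inner_adj[symmetric])

lemma inner_smult_left: "(c *s x) \<bullet> y = x \<bullet> (cnj c *s (y :: complex ^ 'n))"
  by (simp add: inner_vec_complex mult_ac)

lemma hpd_imp_hpsd: "hpd A \<Longrightarrow> hpsd A"
  unfolding hpd_def hpsd_def by (metis inner_zero_left order.refl order.strict_implies_order)

text \<open>Splitting a scalar into real and imaginary part reduces complex linearity to commutation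
  with \<open>\<i>\<close>. This is what allows a real-linear root to be represented by a complex
  matrix.\<close>

lemma complex_linear_of_real_linear:
  fixes g :: "complex ^ 'n \<Rightarrow> complex ^ 'm"
  assumes g: "linear g" and i: "\<And>x. g (\<i> *s x) = \<i> *s g x"
  shows "Vector_Spaces.linear (*s) (*s) g"
proof unfold_locales
  show "g (x + y) = g x + g y" for x y
    by (rule linear_add[OF g])
  fix c x
  have *: "c *s y = Re c *\<^sub>R y + Im c *\<^sub>R (\<i> *s y)" for y :: "complex ^ 'k"
    by (simp add: vec_eq_iff complex_eq_iff)
  show "g (c *s x) = c *s g x"
    by (simp only: *[of x] *[of "g x"] linear_add[OF g] linear_cmul[OF g] i)
qed

section \<open>Existence and uniqueness of the Hermitian positive semidefinite root\<close>

lemma hpsd_sqrt_exists: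
  assumes "hpsd A"
  shows "\<exists>B. hpsd B \<and> B ** B = A"
proof -
  have sym: "(A *v x) \<bullet> y = x \<bullet> (A *v y)" for x y
    using assms adj_eq_self_iff unfolding hpsd_def by blast
  obtain g where g: "linear g" "\<And>x y. g x \<bullet> y = x \<bullet> g y" "\<And>x. 0 \<le> x \<bullet> g x"
      and gg: "g \<circ> g = (*v) A"
    by (rule psd_map_sqrt_exists[of "(*v) A"])
      (use assms sym in \<open>auto simp: hpsd_def matrix_vector_mul_linear\<close>)
  \<comment> \<open>Conjugating the real-linear root \<open>g\<close> by the complex structure gives another root, so by
    uniqueness \<open>g\<close> is complex linear.\<close>
  define h where "h = (\<lambda>x. - \<i> *s g (\<i> *s x))"
  have i: "linear (\<lambda>x :: complex ^ 'a. \<i> *s x)" "linear (\<lambda>x :: complex ^ 'a. - \<i> *s x)"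
    by (auto intro!: linearI simp: vec_eq_iff algebra_simps)
  have "g = h"
  proof (rule psd_map_sqrt_unique[OF g])
    show "linear h"
      using linear_compose[OF linear_compose[OF i(1) g(1)] i(2)] by (simp add: h_def o_def)
    have *: "h x \<bullet> y = g (\<i> *s x) \<bullet> (\<i> *s y)" "x \<bullet> h y = (\<i> *s x) \<bullet> g (\<i> *s y)" for x y
      by (simp_all add: h_def inner_smult_left)
    show "h x \<bullet> y = x \<bullet> h y" "0 \<le> x \<bullet> h x" for x y
      unfolding * by (fact g(2) g(3))+
    \<comment> \<open>\<open>g \<circ> g\<close> is multiplication by \<open>A\<close>, which is
      complex linear.\<close>
    have "g (g (\<i> *s x)) = \<i> *s g (g x)" for x
      using gg by (metis comp_apply matrix_vector_mult_scaleR vector_scalar_commute)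
    then show "g \<circ> g = h \<circ> h"
      by (auto simp: h_def fun_eq_iff)
  qed
  moreover have "\<i> *s h x = g (\<i> *s x)" for x
    by (simp add: h_def vec_eq_iff)
  ultimately have "g (\<i> *s x) = \<i> *s g x" for x
    by metis
  then have "Vector_Spaces.linear (*s) (*s) g"
    by (rule complex_linear_of_real_linear[OF g(1)])
  then have B: "(*v) (matrix g) = g"
    by (simp add: fun_eq_iff matrix_works)
  have "hpsd (matrix g)"
    using g(2,3) by (simp add: hpsd_def adj_eq_self_iff B)
  moreover have "matrix g ** matrix g = A"
    using gg by (simp add: matrix_eq fun_eq_iff B flip: matrix_vector_mul_assoc)
  ultimately show ?thesis
    by blast
qed

lemma hpsd_sqrt_unique:
  assumes "hpsd B" "hpsd C" "B ** B = C ** C"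
  shows "B = C"
proof -
  have "(*v) B = (*v) C"
  proof (rule psd_map_sqrt_unique)
    show "(*v) B \<circ> (*v) B = (*v) C \<circ> (*v) C"
      by (simp add: fun_eq_iff matrix_vector_mul_assoc assms(3))
  qed (use assms in \<open>auto simp: hpsd_def adj_eq_self_iff\<close>)
  then show ?thesis
    by (metis matrix_eq)
qed

text \<open>Uniqueness of the root turns the definite description into a criterion by which explicit
  roots are recognised.\<close>

lemma msqrt_eqI:
  assumes "hpsd B" "B ** B = A"
  shows "msqrt A = B"
  unfolding msqrt_def
proof (rule the_equality)
  show "C = B" if "hpsd C \<and> C ** C = A" for C
    by (rule hpsd_sqrt_unique) (use that assms in simp_all)
qed (use assms in simp)

lemma msqrt_hpsd:
  assumes "hpsd A"
  shows hpsd_msqrt: "hpsd (msqrt A)" and msqrt_mult_self: "msqrt A ** msqrt A = A"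
proof -
  obtain B where B: "hpsd B" "B ** B = A"
    using hpsd_sqrt_exists[OF assms] by blast
  then have "msqrt A = B"
    by (rule msqrt_eqI)
  with B show "hpsd (msqrt A)" "msqrt A ** msqrt A = A"
    by simp_all
qed

section \<open>Inverses, congruences and convex combinations of positive matrices\<close>

lemma hpd_invertible:
  assumes "hpd A"
  shows "invertible A"
proof -
  have "x = 0" if "A *v x = 0" for x
    using assms that unfolding hpd_def by (metis inner_zero_right less_irrefl)
  then show ?thesis
    unfolding invertible_left_inverse matrix_left_invertible_ker by blast
qed

lemma invertible_matrix_inv:
  fixes A :: "'a::semiring_1 ^ 'n ^ 'm"
  assumes "invertible A"
  shows matrix_inv_right: "A ** matrix_inv A = mat 1"
    and matrix_inv_left: "matrix_inv A ** A = mat 1"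
  using someI_ex[OF assms[unfolded invertible_def]] unfolding matrix_inv_def by simp_all

lemma matrix_inv_eqI:
  fixes A B :: "'a::semiring_1 ^ 'n ^ 'n"
  assumes "A ** B = mat 1" "B ** A = mat 1"
  shows "matrix_inv A = B"
proof -
  have "invertible A"
    using assms unfolding invertible_def by blast
  have "matrix_inv A = (B ** A) ** matrix_inv A"
    by (simp add: assms)
  also have "\<dots> = B"
    using matrix_inv_right[OF \<open>invertible A\<close>] by (simp flip: matrix_mul_assoc)
  finally show ?thesis .
qed

lemma hpsd_congruence:
  assumes "hpsd A"
  shows "hpsd (adj X ** A ** X)"
proof -
  have "x \<bullet> ((adj X ** A ** X) *v x) = (X *v x) \<bullet> (A *v (X *v x))" for x
    by (simp add: inner_adj' flip: matrix_vector_mul_assoc)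
  then show ?thesis
    using assms by (simp add: hpsd_def adj_mult matrix_mul_assoc)
qed

lemma hpd_congruence:
  fixes X :: "complex ^ 'n ^ 'n"
  assumes "hpd A" "invertible X"
  shows "hpd (adj X ** A ** X)"
proof -
  have "X *v x \<noteq> 0" if "x \<noteq> 0" for x
    using assms(2) that unfolding invertible_left_inverse matrix_left_invertible_ker by blast
  moreover have "x \<bullet> ((adj X ** A ** X) *v x) = (X *v x) \<bullet> (A *v (X *v x))" for x
    by (simp add: inner_adj' flip: matrix_vector_mul_assoc)
  ultimately show ?thesis
    using assms(1) by (simp add: hpd_def adj_mult matrix_mul_assoc)
qed

lemma hpsd_add: "hpsd A \<Longrightarrow> hpsd B \<Longrightarrow> hpsd (A + B)"
  by (simp add: hpsd_def adj_add matrix_vector_mult_add_rdistrib inner_add_right)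

lemma hpsd_scaleR: "0 \<le> c \<Longrightarrow> hpsd A \<Longrightarrow> hpsd (c *\<^sub>R A)"
  by (simp add: hpsd_def adj_scaleR scaleR_matrix_vector)

lemma hpd_convex:
  assumes "hpd A" "hpd B" "t \<in> {0..1}"
  shows "hpd ((1 - t) *\<^sub>R A + t *\<^sub>R B)"
\<comment> \<open>Strictness comes from the first summand, whose weight \<open>1 - t\<close>
  vanishes only at \<open>t = 1\<close>.\<close>
proof (cases "t = 1")
  case False
  have "0 < x \<bullet> (((1 - t) *\<^sub>R A + t *\<^sub>R B) *v x)" if "x \<noteq> 0" for x
  proof -
    have "0 < (1 - t) * (x \<bullet> (A *v x))"
      using assms(1,3) False that by (simp add: hpd_def)
    moreover have "0 \<le> t * (x \<bullet> (B *v x))"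
      using assms(2,3) that by (simp add: hpd_def less_imp_le)
    ultimately show ?thesis
      by (simp add: matrix_vector_mult_add_rdistrib scaleR_matrix_vector inner_add_right)
  qed
  then show ?thesis
    using assms(1,2) by (simp add: hpd_def adj_add adj_scaleR)
qed (use assms in simp)

lemma invertible_of_mult_self:
  fixes S :: "'a::field ^ 'n ^ 'n"
  assumes "invertible (S ** S)"
  shows "invertible S"
proof -
  obtain C where "S ** (S ** C) = mat 1"
    using assms unfolding invertible_right_inverse by (auto simp: matrix_mul_assoc)
  then show ?thesis
    unfolding invertible_right_inverse by blast
qed

lemma hpd_mat_1: "hpd (mat 1)"
  by (simp add: hpd_def)

lemma invertible_adj:
  assumes "invertible X"
  shows "invertible (adj X)"
proof -
  obtain Y where "X ** Y = mat 1" "Y ** X = mat 1"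
    using assms unfolding invertible_def by blast
  then have "adj Y ** adj X = mat 1" "adj X ** adj Y = mat 1"
    by (simp_all flip: adj_mult)
  then show ?thesis
    unfolding invertible_def by blast
qed

lemma hpd_mult_adj:
  fixes X :: "complex ^ 'n ^ 'n"
  assumes "invertible X"
  shows "hpd (X ** adj X)"
  using hpd_congruence[OF hpd_mat_1 invertible_adj[OF assms]] by simp

text \<open>With \<open>S\<close> the root, \<open>A = S ** adj S\<close>, and \<open>S\<close> is
  invertible because its square is.\<close>

lemma hpsd_invertible_imp_hpd:
  assumes "hpsd A" "invertible A"
  shows "hpd A"
proof -
  define S where "S = msqrt A"
  have S: "hpsd S" "S ** S = A"
    unfolding S_def by (fact msqrt_hpsd[OF assms(1)])+
  have "invertible S"
    by (rule invertible_of_mult_self[of S, unfolded S(2), OF assms(2)])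
  then have "hpd (S ** adj S)"
    by (rule hpd_mult_adj)
  then show ?thesis
    using S by (simp add: hpsd_def)
qed

lemma msqrt_hpd:
  assumes "hpd A"
  shows "hpd (msqrt A)"
proof (rule hpsd_invertible_imp_hpd)
  have sq: "msqrt A ** msqrt A = A"
    by (simp add: assms hpd_imp_hpsd msqrt_mult_self)
  show "invertible (msqrt A)"
    by (rule invertible_of_mult_self) (simp add: sq hpd_invertible assms)
qed (simp add: assms hpd_imp_hpsd hpsd_msqrt)

text \<open>Once the inverse \<open>B\<close> is known to be Hermitian,
  \<open>B = adj B ** A ** B\<close> exhibits it as a congruence of \<open>A\<close>.\<close>

lemma hpd_matrix_inv:
  assumes "hpd A"
  shows "hpd (matrix_inv A)"
proof -
  let ?B = "matrix_inv A"
  have A: "adj A = A" and inv: "A ** ?B = mat 1" "?B ** A = mat 1"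
    using assms invertible_matrix_inv[OF hpd_invertible[OF assms]] by (simp_all add: hpd_def)
  have "adj ?B = ?B"
    using matrix_inv_eqI[of A "adj ?B"] arg_cong[OF inv(1), of adj] arg_cong[OF inv(2), of adj] A
    by (simp add: adj_mult)
  moreover have "invertible ?B"
    using inv unfolding invertible_def by blast
  then have "hpd (adj ?B ** A ** ?B)"
    by (rule hpd_congruence[OF assms])
  ultimately show ?thesis
    by (simp only: inv matrix_mul_lid)
qed

section \<open>Fourier expansion on the discrete torus\<close>

text \<open>The grid corresponds to a product of integer intervals, so sums of products over it
  factor by distributivity.\<close>

lemma finite_grid [simp]: "finite (grid N)"
  and sum_grid_prod: "(\<Sum>t\<in>grid N. \<Prod>i\<in>UNIV. f i (t $ i)) =
    (\<Prod>i\<in>UNIV. \<Sum>s\<in>{0..int (N $ i) - 1}. f i s :: 'a::comm_semiring_1)"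
proof -
  let ?P = "PiE UNIV (\<lambda>i. {0..int (N $ i) - 1})"
  have "t \<in> vec_lambda ` ?P" if "t \<in> grid N" for t
    using that by (intro image_eqI[of _ _ "vec_nth t"]) (auto simp: grid_def)
  then have eq: "grid N = vec_lambda ` ?P"
    by (auto simp: grid_def PiE_iff)
  have "finite ?P"
    by (intro finite_PiE) auto
  then show "finite (grid N)"
    by (simp add: eq)
  have "inj_on vec_lambda ?P"
    by (auto intro!: inj_onI simp: vec_lambda_inject)
  then show "(\<Sum>t\<in>grid N. \<Prod>i\<in>UNIV. f i (t $ i)) =
      (\<Prod>i\<in>UNIV. \<Sum>s\<in>{0..int (N $ i) - 1}. f i s)"
    by (simp add: eq sum.reindex prod_sum_PiE)
qed

text \<open>A geometric sum: for \<open>w \<noteq> 1\<close> its numerator \<open>w ^ n - 1\<close>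
  vanishes.\<close>

lemma sum_powi_root_of_unity:
  fixes w :: complex
  assumes "w ^ n = 1"
  shows "(\<Sum>s\<in>{0..int n - 1}. w powi s) = (if w = 1 then of_nat n else 0)"
proof -
  have "s \<in> int ` {..<n}" if "s \<in> {0..int n - 1}" for s
    using that by (intro image_eqI[of _ _ "nat s"]) auto
  then have "{0..int n - 1} = int ` {..<n}"
    by auto
  then have "(\<Sum>s\<in>{0..int n - 1}. w powi s) = (\<Sum>k<n. w ^ k)"
    by (simp add: sum.reindex)
  then show ?thesis
    using assms by (simp add: geometric_sum)
qed

lemma zeta_nth: "zeta N l $ i = exp (2 * of_real pi * \<i> * of_int (l $ i) / of_nat (N $ i))"
  by (simp add: zeta_def mult_ac)

lemma zeta_nonzero [simp]: "zeta N l $ i \<noteq> 0"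
  by (simp add: zeta_nth)

lemma zeta_power:
  assumes "N $ i \<ge> 1"
  shows "(zeta N l $ i) ^ (N $ i) = 1"
proof -
  have "(zeta N l $ i) ^ (N $ i) = exp (2 * of_int (l $ i) * of_real pi * \<i>)"
    using assms by (simp add: zeta_nth mult_ac flip: exp_of_nat_mult)
  then show ?thesis
    by (simp add: exp_eq_1)
qed

lemma zeta_nth_inject:
  assumes "l \<in> grid N" "k \<in> grid N" "N $ i \<ge> 1"
  shows "zeta N l $ i = zeta N k $ i \<longleftrightarrow> l $ i = k $ i"
proof -
  have *: "0 \<le> l $ i" "l $ i < int (N $ i)" "0 \<le> k $ i" "k $ i < int (N $ i)"
    using assms(1,2) by (auto simp: grid_def)
  show ?thesis
    using complex_root_unity_eq[of "N $ i" "nat (l $ i)" "nat (k $ i)"] * assms(3)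
    by (simp add: zeta_nth nat_less_iff eq_nat_nat_iff)
qed

text \<open>Each summand is a monomial in the coordinatewise ratios of the two points, so the sum
  factors. These ratios are roots of unity, equal to one exactly where \<open>l\<close> and
  \<open>k\<close> agree; a single differing coordinate annihilates the product.\<close>

lemma zmonom_orthogonal:
  assumes N: "\<And>i. N $ i \<ge> 1" and l: "l \<in> grid N" and k: "k \<in> grid N"
  shows "(\<Sum>t\<in>grid N. zmonom (zeta N l) t * zmonom (zeta N k) (- t)) =
    (if l = k then of_nat (\<Prod>i\<in>UNIV. N $ i) else 0)"
proof -
  let ?w = "\<lambda>i. zeta N l $ i / zeta N k $ i"
  have "(\<Sum>t\<in>grid N. zmonom (zeta N l) t * zmonom (zeta N k) (- t)) =
      (\<Sum>t\<in>grid N. \<Prod>i\<in>UNIV. ?w i powi (t $ i))"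
    by (simp add: zmonom_def power_int_minus power_int_divide_distrib divide_inverse
        power_int_mult_distrib power_int_inverse flip: prod.distrib)
  also have "\<dots> = (\<Prod>i\<in>UNIV. \<Sum>s\<in>{0..int (N $ i) - 1}. ?w i powi s)"
    by (rule sum_grid_prod)
  also have "\<dots> = (\<Prod>i\<in>UNIV. if l $ i = k $ i then of_nat (N $ i) else 0)"
  proof (intro prod.cong refl)
    fix i
    have "?w i ^ N $ i = 1" "?w i = 1 \<longleftrightarrow> l $ i = k $ i"
      using N by (simp_all add: power_divide zeta_power zeta_nth_inject[OF l k])
    then show "(\<Sum>s\<in>{0..int (N $ i) - 1}. ?w i powi s) =
        (if l $ i = k $ i then of_nat (N $ i) else 0)"
      by (simp only: sum_powi_root_of_unity)
  qed
  also have "\<dots> = (if l = k then of_nat (\<Prod>i\<in>UNIV. N $ i) else 0)"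
    by (auto simp: vec_eq_iff)
  finally show ?thesis .
qed

lemma discrete_fourier_expansion:
  fixes F :: "complex ^ 'd \<Rightarrow> complex"
  assumes N: "\<And>i. N $ i \<ge> 1"
  shows "\<exists>c. \<forall>k\<in>grid N. F (zeta N k) = (\<Sum>t\<in>grid N. c t * zmonom (zeta N k) (- t))"
proof -
  define n where "n = (of_nat (\<Prod>i\<in>UNIV. N $ i) :: complex)"
  have n: "n \<noteq> 0"
    using N unfolding n_def by (simp add: Suc_le_eq)
  \<comment> \<open>The inverse discrete Fourier transform: exponents of opposite sign to the
    expansion, divided by the number of grid points.\<close>
  define c where "c = (\<lambda>t. (\<Sum>l\<in>grid N. F (zeta N l) * zmonom (zeta N l) t) / n)"
  have "(\<Sum>t\<in>grid N. c t * zmonom (zeta N k) (- t)) = F (zeta N k)" if k: "k \<in> grid N" for k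
  proof -
    have "(\<Sum>t\<in>grid N. c t * zmonom (zeta N k) (- t)) =
        (\<Sum>l\<in>grid N. F (zeta N l) *
          (\<Sum>t\<in>grid N. zmonom (zeta N l) t * zmonom (zeta N k) (- t)) / n)"
      unfolding c_def sum_divide_distrib sum_distrib_left sum_distrib_right
      by (subst sum.swap) (simp add: mult_ac)
    also have "\<dots> = (\<Sum>l\<in>grid N. if l = k then F (zeta N k) else 0)"
      by (intro sum.cong refl) (simp add: zmonom_orthogonal[OF N _ k, folded n_def] n)
    finally show ?thesis
      using k by simp
  qed
  then show ?thesis
    by (intro exI[of _ c]) simp
qed

section \<open>Conjugation symmetry and real Fourier coefficients\<close>

text \<open>On the torus, whose coordinates have modulus one, this is the reflection of
  \<open>z\<close> to its coordinatewise inverse.\<close>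

definition vcnj :: "complex ^ 'd \<Rightarrow> complex ^ 'd" where
  "vcnj z = (\<chi> i. cnj (z $ i))"

lemma vcnj_zeta_grid:
  assumes "l \<in> grid N"
  shows "\<exists>k\<in>grid N. zeta N k = vcnj (zeta N l)"
proof
  \<comment> \<open>The index \<open>- l\<close> modulo \<open>N\<close>. A zero coordinate is kept
    apart because \<open>N $ i\<close> itself lies outside the grid.\<close>
  let ?k = "\<chi> i. if l $ i = 0 then 0 else int (N $ i) - l $ i"
  have l: "0 \<le> l $ i" "l $ i \<le> int (N $ i) - 1" for i
    using assms by (auto simp: grid_def)
  have "0 \<le> ?k $ i \<and> ?k $ i \<le> int (N $ i) - 1" for i
    using l[of i] by auto
  then show "?k \<in> grid N"
    unfolding grid_def by blast
  show "zeta N ?k = vcnj (zeta N l)"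
  proof (rule vec_eq_iff[THEN iffD2], rule allI)
    fix i
    have N: "N $ i \<noteq> 0"
      using l[of i] by simp
    have "cnj (zeta N l $ i) = exp (- (2 * of_real pi * \<i> * of_int (l $ i) / of_nat (N $ i)))"
      by (simp add: zeta_nth exp_cnj)
    \<comment> \<open>Adding the full period \<open>2 * of_real pi * \<i>\<close> moves the negative
      index back into the grid.\<close>
    also have "\<dots> = exp (2 * of_real pi * \<i> - 2 * of_real pi * \<i> * of_int (l $ i) / of_nat (N $ i))"
      by (simp add: exp_diff exp_minus divide_inverse)
    also have "2 * of_real pi * \<i> - 2 * of_real pi * \<i> * of_int (l $ i) / of_nat (N $ i) =
        2 * of_real pi * \<i> * of_int (int (N $ i) - l $ i) / of_nat (N $ i)"
      using N by (simp add: field_simps)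
    finally show "zeta N ?k $ i = vcnj (zeta N l) $ i"
      using exp_two_pi_i by (simp add: zeta_nth vcnj_def mult.assoc)
  qed
qed

lemma zmonom_vcnj: "zmonom (vcnj z) t = cnj (zmonom z t)"
  by (simp add: zmonom_def vcnj_def)

lemma trig_matrix_vcnj: "trig_matrix N C (vcnj z) = map_matrix cnj (trig_matrix N C z)"
  by (simp add: trig_matrix_def vec_eq_iff zmonom_vcnj)

text \<open>Any complex Fourier expansion at \<open>l\<close> may be averaged with the conjugate of
  the one at the reflected index. Both use the same monomials, so the average replaces every
  coefficient by its real part.\<close>

lemma trig_matrix_if_cnj_symmetric:
  fixes F :: "complex ^ 'd \<Rightarrow> complex ^ 'm ^ 'm"
  assumes N: "\<And>i. N $ i \<ge> 1"
    and sym: "\<And>l. l \<in> grid N \<Longrightarrow> F (vcnj (zeta N l)) = map_matrix cnj (F (zeta N l))"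
  shows "\<exists>R. \<forall>l\<in>grid N. F (zeta N l) = trig_matrix N R (zeta N l)"
proof -
  have "\<exists>c. \<forall>k\<in>grid N. F (zeta N k) $ a $ b = (\<Sum>t\<in>grid N. c t * zmonom (zeta N k) (- t))"
    for a b
    using discrete_fourier_expansion[OF N, of "\<lambda>z. F z $ a $ b"] .
  then obtain c where c: "\<And>a b k. k \<in> grid N \<Longrightarrow>
      F (zeta N k) $ a $ b = (\<Sum>t\<in>grid N. c a b t * zmonom (zeta N k) (- t))"
    by metis
  have "F (zeta N l) $ a $ b = (\<Sum>t\<in>grid N. of_real (Re (c a b t)) * zmonom (zeta N l) (- t))"
    if l: "l \<in> grid N" for l a b
  proof -
    obtain k where k: "k \<in> grid N" "zeta N k = vcnj (zeta N l)"
      using vcnj_zeta_grid[OF l] by blast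
    have "cnj (F (zeta N l) $ a $ b) = F (zeta N k) $ a $ b"
      using sym[OF l] by (simp add: k(2))
    then have "F (zeta N l) $ a $ b = cnj (F (zeta N k) $ a $ b)"
      by (metis complex_cnj_cnj)
    also have "\<dots> = (\<Sum>t\<in>grid N. cnj (c a b t) * zmonom (zeta N l) (- t))"
      using c[OF k(1), of a b] by (simp add: k(2) zmonom_vcnj)
    finally have "2 * F (zeta N l) $ a $ b =
        (\<Sum>t\<in>grid N. (c a b t + cnj (c a b t)) * zmonom (zeta N l) (- t))"
      using c[OF l, of a b] by (simp add: sum.distrib distrib_right)
    also have "\<dots> = 2 * (\<Sum>t\<in>grid N. of_real (Re (c a b t)) * zmonom (zeta N l) (- t))"
      by (simp add: complex_add_cnj sum_distrib_left mult.assoc)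
    finally show ?thesis
      by simp
  qed
  then show ?thesis
    by (intro exI[of _ "\<lambda>t. \<chi> a b. Re (c a b t)"]) (simp add: trig_matrix_def vec_eq_iff)
qed

section \<open>The integrand of the weighted Hellinger distance\<close>

lemma matrix_add_rdistrib: "(A + B) ** C = A ** C + B ** (C :: complex ^ 'n ^ 'm)"
  by (simp add: vec_eq_iff matrix_matrix_mult_def distrib_right sum.distrib)

lemma matrix_diff_ldistrib: "A ** (B - C) = A ** B - A ** (C :: complex ^ 'n ^ 'm)"
  by (simp add: vec_eq_iff matrix_matrix_mult_def right_diff_distrib sum_subtractf)

lemma matrix_diff_rdistrib: "(A - B) ** C = A ** C - B ** (C :: complex ^ 'n ^ 'm)"
  by (simp add: vec_eq_iff matrix_matrix_mult_def left_diff_distrib sum_subtractf)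

lemma adj_diff: "adj (A - B) = adj A - adj B"
  by (simp add: vec_eq_iff)

lemma trace_scaleR: "trace (c *\<^sub>R A) = c *\<^sub>R trace (A :: complex ^ 'n ^ 'n)"
  by (simp add: trace_def scaleR_sum_right)

lemma trace_sum: "trace (\<Sum>i\<in>I. f i) = (\<Sum>i\<in>I. trace (f i :: 'a::comm_semiring_1 ^ 'n ^ 'n))"
  by (induction I rule: infinite_finite_induct) (simp_all add: trace_add, simp_all add: trace_def)

text \<open>Writing \<open>A = adj S ** S\<close> makes the trace a sum of squared moduli.\<close>

lemma trace_hpsd:
  assumes "hpsd A"
  shows "\<exists>r\<ge>0. trace A = complex_of_real r"
proof (intro exI conjI)
  let ?S = "msqrt A"
  have S: "adj ?S ** ?S = A"
    using msqrt_hpsd[OF assms] by (simp add: hpsd_def)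
  have "trace (adj ?S ** ?S) = of_real (\<Sum>i\<in>UNIV. \<Sum>j\<in>UNIV. (cmod (?S $ j $ i))\<^sup>2)"
    by (simp add: trace_def matrix_matrix_mult_def mult.commute flip: complex_norm_square)
  then show "trace A = of_real (\<Sum>i\<in>UNIV. \<Sum>j\<in>UNIV. (cmod (?S $ j $ i))\<^sup>2)"
    by (simp only: S)
qed (intro sum_nonneg zero_le_power2)

text \<open>If \<open>Y = Q\<^sup>1\<^sup>/\<^sup>2 Z\<close> is the polar decomposition, then \<open>Z (Y\<^sup>* \<Omega> X) Z\<^sup>*\<close> is the root in question.\<close>

lemma trace_msqrt_sandwich:
  fixes W X Y :: "complex ^ 'n ^ 'n"
  assumes W: "adj W = W" and Y: "invertible Y" and G: "hpsd (adj Y ** W ** X)"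
  defines "P \<equiv> X ** adj X" and "Q \<equiv> Y ** adj Y"
  shows "trace (msqrt (msqrt Q ** W ** P ** W ** msqrt Q)) = trace (adj Y ** W ** X)"
proof -
  define S where "S = msqrt Q"
  have "hpd Q"
    unfolding Q_def by (rule hpd_mult_adj[OF Y])
  then have "hpd S" and SS: "S ** S = Q"
    unfolding S_def by (simp_all add: msqrt_hpd hpd_imp_hpsd msqrt_mult_self)
  then have S: "adj S = S" and inv: "S ** matrix_inv S = mat 1" "matrix_inv S ** S = mat 1"
    by (simp_all add: hpd_def hpd_invertible matrix_inv_left matrix_inv_right)
  have iS: "adj (matrix_inv S) = matrix_inv S"
    using hpd_matrix_inv[OF \<open>hpd S\<close>] by (simp add: hpd_def)
  define Z where "Z = matrix_inv S ** Y"
  have SZ: "S ** Z = Y"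
    by (simp add: Z_def matrix_mul_assoc inv)
  \<comment> \<open>\<open>Q\<close> is both \<open>Y ** adj Y\<close> and \<open>S ** S\<close>, so
    the polar factor \<open>Z\<close> is unitary.\<close>
  have "Z ** adj Z = matrix_inv S ** (S ** S) ** matrix_inv S"
    by (simp add: Z_def adj_mult iS SS Q_def matrix_mul_assoc)
  also have "\<dots> = mat 1"
    by (simp add: matrix_mul_assoc inv)
  finally have ZZ: "Z ** adj Z = mat 1" .
  then have ZZ': "adj Z ** Z = mat 1"
    by (simp add: matrix_left_right_inverse)
  let ?G = "adj Y ** W ** X"
  have "Z ** ?G = (Z ** adj Z) ** S ** W ** X"
    by (simp add: S adj_mult matrix_mul_assoc flip: SZ)
  then have ZG: "Z ** ?G = S ** W ** X"
    by (simp add: ZZ)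
  have adjG: "adj ?G = ?G"
    using G by (simp add: hpsd_def)
  have "msqrt (S ** W ** P ** W ** S) = Z ** ?G ** adj Z"
  proof (rule msqrt_eqI)
    show "hpsd (Z ** ?G ** adj Z)"
      using hpsd_congruence[OF G, of "adj Z"] by simp
    have "(Z ** ?G ** adj Z) ** (Z ** ?G ** adj Z) = (Z ** ?G) ** (adj Z ** Z) ** ?G ** adj Z"
      by (simp only: matrix_mul_assoc)
    also have "\<dots> = (Z ** ?G) ** (?G ** adj Z)"
      by (simp only: ZZ' matrix_mul_rid matrix_mul_assoc)
    \<comment> \<open>As \<open>?G\<close> is Hermitian, the square takes the form
      \<open>V ** adj V\<close> with \<open>V = S ** W ** X\<close>.\<close>
    also have "?G ** adj Z = adj (Z ** ?G)"
      by (simp only: adj_mult[of Z ?G] adjG)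
    also have "(Z ** ?G) ** adj (Z ** ?G) = (S ** W ** X) ** adj (S ** W ** X)"
      by (simp only: ZG)
    also have "\<dots> = S ** W ** P ** W ** S"
      by (simp only: adj_mult S W P_def matrix_mul_assoc)
    finally show "(Z ** ?G ** adj Z) ** (Z ** ?G ** adj Z) = S ** W ** P ** W ** S" .
  qed
  moreover have "trace (Z ** ?G ** adj Z) = trace (adj Z ** (Z ** ?G))"
    by (rule trace_mul_sym)
  moreover have "adj Z ** (Z ** ?G) = ?G"
    by (simp only: matrix_mul_assoc ZZ' matrix_mul_lid)
  ultimately show ?thesis
    by (simp add: S_def)
qed

text \<open>Expanding the square on the right gives two cross terms, which coincide because
  \<open>adj Y ** W ** X\<close> is Hermitian; each has the trace of the root. The other two terms
  match by cyclicity of the trace.\<close>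

lemma hellinger_summand:
  fixes W X Y :: "complex ^ 'n ^ 'n"
  assumes W: "adj W = W" and Y: "invertible Y" and G: "hpsd (adj Y ** W ** X)"
  defines "P \<equiv> X ** adj X" and "Q \<equiv> Y ** adj Y"
  shows "trace (W ** P + W ** Q - 2 *\<^sub>R msqrt (msqrt Q ** W ** P ** W ** msqrt Q)) =
    trace (adj (X - Y) ** W ** (X - Y))"
proof -
  have *: "trace (W ** (V ** adj V)) = trace (adj V ** W ** V)" for V :: "complex ^ 'n ^ 'n"
    using trace_mul_sym[of "W ** V" "adj V"] by (simp add: matrix_mul_assoc)
  have "adj X ** W ** Y = adj (adj Y ** W ** X)"
    by (simp add: adj_mult W matrix_mul_assoc)
  then have "adj X ** W ** Y = adj Y ** W ** X"
    using G by (simp add: hpsd_def)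
  then have "adj (X - Y) ** W ** (X - Y) =
      adj X ** W ** X + adj Y ** W ** Y - (adj Y ** W ** X + adj Y ** W ** X)"
    by (simp add: adj_diff matrix_diff_ldistrib matrix_diff_rdistrib algebra_simps)
  then have "trace (adj (X - Y) ** W ** (X - Y)) =
      trace (adj X ** W ** X) + trace (adj Y ** W ** Y) -
      (trace (adj Y ** W ** X) + trace (adj Y ** W ** X))"
    by (simp only: trace_add trace_sub)
  then show ?thesis
    unfolding P_def Q_def trace_add trace_sub trace_scaleR
    by (simp add: * trace_msqrt_sandwich[OF W Y G] scaleR_2)
qed

text \<open>A segment \<open>X\<^sub>0 + \<tau> (X\<^sub>1 - X\<^sub>0)\<close> of factors projects to a geodesic as soon as its endpoints
  are optimally aligned, i.e. \<open>X\<^sub>0\<^sup>* \<Omega> X\<^sub>1\<close> is positive.\<close>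

context
  fixes W X0 X1 :: "complex ^ 'n ^ 'n"
  assumes W: "hpd W" and X0: "invertible X0" and M: "hpd (adj X0 ** W ** X1)"
begin

text \<open>Multiplied by \<open>adj X0 ** W\<close> from the left, the segment becomes a convex
  combination of two positive definite matrices, hence invertible.\<close>

lemma invertible_segment:
  assumes "t \<in> {0..1}"
  shows "invertible ((1 - t) *\<^sub>R X0 + t *\<^sub>R X1)"
proof -
  let ?X = "(1 - t) *\<^sub>R X0 + t *\<^sub>R X1"
  have "hpd ((1 - t) *\<^sub>R (adj X0 ** W ** X0) + t *\<^sub>R (adj X0 ** W ** X1))"
    by (rule hpd_convex[OF hpd_congruence[OF W X0] M assms])
  then have "hpd (adj X0 ** W ** ?X)"
    by (simp add: matrix_add_ldistrib scaleR_matrix_mult_right)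
  then obtain C where "C ** (adj X0 ** W ** ?X) = mat 1"
    using hpd_invertible unfolding invertible_left_inverse by blast
  then have "(C ** adj X0 ** W) ** ?X = mat 1"
    by (simp only: matrix_mul_assoc)
  then show ?thesis
    unfolding invertible_left_inverse by blast
qed

text \<open>In the expansion both mixed products equal \<open>adj X0 ** W ** X1\<close>, since that
  matrix is Hermitian, and all coefficients are nonnegative on the unit interval.\<close>

lemma hpsd_segment_pair:
  assumes "s \<in> {0..1}" "t \<in> {0..1}"
  shows "hpsd (adj ((1 - t) *\<^sub>R X0 + t *\<^sub>R X1) ** W ** ((1 - s) *\<^sub>R X0 + s *\<^sub>R X1))"
proof -
  have "adj (adj X0 ** W ** X1) = adj X0 ** W ** X1" "adj W = W"
    using M W by (simp_all add: hpd_def)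
  then have M': "adj X1 ** W ** X0 = adj X0 ** W ** X1"
    by (simp add: adj_mult matrix_mul_assoc)
  have "adj ((1 - t) *\<^sub>R X0 + t *\<^sub>R X1) ** W ** ((1 - s) *\<^sub>R X0 + s *\<^sub>R X1) =
      ((1 - t) * (1 - s)) *\<^sub>R (adj X0 ** W ** X0) +
      (((1 - t) * s + t * (1 - s)) *\<^sub>R (adj X0 ** W ** X1) +
       (t * s) *\<^sub>R (adj X1 ** W ** X1))"
    by (simp add: adj_add adj_scaleR matrix_add_ldistrib matrix_add_rdistrib scaleR_matrix_mult_left
        scaleR_matrix_mult_right M' scaleR_add_right scaleR_add_left mult.commute)
  also have "hpsd \<dots>"
    using assms W M by (intro hpsd_add hpsd_scaleR hpsd_congruence hpd_imp_hpsd) auto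
  finally show ?thesis .
qed

end

section \<open>Entrywise conjugation\<close>

lemma map_cnj_mult: "map_matrix cnj (A ** B) = map_matrix cnj A ** map_matrix cnj B"
  by (simp add: vec_eq_iff matrix_matrix_mult_def)

lemma map_cnj_add: "map_matrix cnj (A + B) = map_matrix cnj A + map_matrix cnj B"
  by (simp add: vec_eq_iff)

lemma map_cnj_scaleR: "map_matrix cnj (c *\<^sub>R A) = c *\<^sub>R map_matrix cnj A"
  by (simp add: vec_eq_iff)

lemma map_cnj_adj: "map_matrix cnj (adj A) = adj (map_matrix cnj A)"
  by (simp add: vec_eq_iff)

lemma map_cnj_mat_1: "map_matrix cnj (mat 1) = mat 1"
  by (simp add: vec_eq_iff mat_def)

text \<open>The conjugated matrix acts as \<open>A\<close> between two applications of
  \<open>vcnj\<close>, and \<open>vcnj\<close> moves across the real inner product.\<close>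

lemma hpsd_map_cnj:
  fixes A :: "complex ^ 'n ^ 'n"
  assumes "hpsd A"
  shows "hpsd (map_matrix cnj A)"
proof -
  have "map_matrix cnj A *v x = vcnj (A *v vcnj x)" for x
    by (simp add: vec_eq_iff vcnj_def matrix_vector_mult_def)
  moreover have "x \<bullet> vcnj y = vcnj x \<bullet> y" for x y :: "complex ^ 'n"
    by (simp add: inner_vec_def inner_complex_def vcnj_def)
  ultimately show ?thesis
    using assms by (simp add: hpsd_def flip: map_cnj_adj)
qed

lemma msqrt_map_cnj:
  assumes "hpsd A"
  shows "msqrt (map_matrix cnj A) = map_matrix cnj (msqrt A)"
  by (rule msqrt_eqI)
    (simp_all add: hpsd_map_cnj hpsd_msqrt assms msqrt_mult_self flip: map_cnj_mult)

lemma matrix_inv_map_cnj: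
  assumes "invertible A"
  shows "matrix_inv (map_matrix cnj A) = map_matrix cnj (matrix_inv (A :: complex ^ 'n ^ 'n))"
  by (rule matrix_inv_eqI)
    (simp_all add: map_cnj_mat_1 matrix_inv_left matrix_inv_right assms flip: map_cnj_mult)

section \<open>Geodesics\<close>

text \<open>The sign condition makes the square root unique, which resolves the definite
  description; the trace is taken inside the sum.\<close>

lemma hellinger_eqI:
  assumes "0 \<le> \<delta>"
    and "complex_of_real (\<delta>\<^sup>2) = 1 / of_nat (\<Prod>i\<in>UNIV. N $ i) *
      (\<Sum>l\<in>grid N. trace (W (zeta N l) ** P (zeta N l) + W (zeta N l) ** Q (zeta N l)
         - 2 *\<^sub>R msqrt (msqrt (Q (zeta N l)) ** W (zeta N l) ** P (zeta N l) ** W (zeta N l) **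
             msqrt (Q (zeta N l)))))"
  shows "hellinger N W P Q = \<delta>"
  unfolding hellinger_def
proof (rule the_equality)
  fix \<delta>'
  assume *: "0 \<le> \<delta>' \<and> complex_of_real (\<delta>'\<^sup>2) = 1 / of_nat (\<Prod>i\<in>UNIV. N $ i) *
       trace (\<Sum>l\<in>grid N. let z = zeta N l in
         W z ** P z + W z ** Q z
         - 2 *\<^sub>R msqrt (msqrt (Q z) ** W z ** P z ** W z ** msqrt (Q z)))"
  then have "complex_of_real (\<delta>'\<^sup>2) = complex_of_real (\<delta>\<^sup>2)"
    unfolding assms(2) trace_sum Let_def by blast
  then have "\<delta>'\<^sup>2 = \<delta>\<^sup>2"
    by (simp only: of_real_eq_iff)
  then show "\<delta>' = \<delta>"
    using * assms(1) by (simp add: power2_eq_iff_nonneg)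
next
  show "0 \<le> \<delta> \<and> complex_of_real (\<delta>\<^sup>2) = 1 / of_nat (\<Prod>i\<in>UNIV. N $ i) *
       trace (\<Sum>l\<in>grid N. let z = zeta N l in
         W z ** P z + W z ** Q z
         - 2 *\<^sub>R msqrt (msqrt (Q z) ** W z ** P z ** W z ** msqrt (Q z)))"
    unfolding assms(2) trace_sum Let_def using assms(1) by blast
qed

text \<open>The path agrees with its prescribed endpoints on the torus only, so the distance has to
  be blind to values elsewhere.\<close>

lemma hellinger_cong:
  assumes "\<And>l. l \<in> grid N \<Longrightarrow> P (zeta N l) = P' (zeta N l)"
    and "\<And>l. l \<in> grid N \<Longrightarrow> Q (zeta N l) = Q' (zeta N l)"
  shows "hellinger N W P Q = hellinger N W P' Q'"
  unfolding hellinger_def using assms by (simp add: Let_def)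

text \<open>Differences of segment points are multiples of \<open>X\<^sub>1 - X\<^sub>0\<close>, so
  every summand of the squared distance is \<open>(s - t)\<^sup>2\<close> times a number independent
  of \<open>s\<close> and \<open>t\<close>.\<close>

lemma hellinger_geodesic_segment:
  fixes X\<^sub>0 X\<^sub>1 W :: "complex ^ 'd \<Rightarrow> complex ^ 'm ^ 'm"
  assumes W: "\<And>l. l \<in> grid N \<Longrightarrow> hpd (W (zeta N l))"
    and X\<^sub>0: "\<And>l. l \<in> grid N \<Longrightarrow> invertible (X\<^sub>0 (zeta N l))"
    and M: "\<And>l. l \<in> grid N \<Longrightarrow> hpd (adj (X\<^sub>0 (zeta N l)) ** W (zeta N l) ** X\<^sub>1 (zeta N l))"
  defines "X \<equiv> \<lambda>t z. (1 - t) *\<^sub>R X\<^sub>0 z + t *\<^sub>R X\<^sub>1 z"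
  shows "\<exists>\<delta>. \<forall>s\<in>{0..1}. \<forall>t\<in>{0..1}.
    hellinger N W (\<lambda>z. X s z ** adj (X s z)) (\<lambda>z. X t z ** adj (X t z)) = \<bar>s - t\<bar> * \<delta>"
proof -
  define D where "D = (\<lambda>z. adj (X\<^sub>1 z - X\<^sub>0 z) ** W z ** (X\<^sub>1 z - X\<^sub>0 z))"
  have "\<exists>r\<ge>0. trace (D (zeta N l)) = complex_of_real r" if "l \<in> grid N" for l
    unfolding D_def by (intro trace_hpsd hpsd_congruence hpd_imp_hpsd W that)
  then obtain r where r: "\<And>l. l \<in> grid N \<Longrightarrow> 0 \<le> r l \<and> trace (D (zeta N l)) = of_real (r l)"
    by metis
  let ?n = "real (\<Prod>i\<in>UNIV. N $ i)"
  \<comment> \<open>The constant speed of the segment: the root of the average of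
    \<open>trace (D z)\<close> over the torus.\<close>
  define \<delta> where "\<delta> = sqrt (1 / ?n * (\<Sum>l\<in>grid N. r l))"
  have "0 \<le> (\<Sum>l\<in>grid N. r l)"
    using r by (simp add: sum_nonneg)
  then have \<delta>: "0 \<le> \<delta>" "\<delta>\<^sup>2 = 1 / ?n * (\<Sum>l\<in>grid N. r l)"
    unfolding \<delta>_def by (simp_all add: prod_nonneg sum_nonneg del: of_nat_prod)
  have "hellinger N W (\<lambda>z. X s z ** adj (X s z)) (\<lambda>z. X t z ** adj (X t z)) = \<bar>s - t\<bar> * \<delta>"
    if s: "s \<in> {0..1}" and t: "t \<in> {0..1}" for s t
  proof (rule hellinger_eqI)
    have "trace (W z ** (X s z ** adj (X s z)) + W z ** (X t z ** adj (X t z))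
        - 2 *\<^sub>R msqrt (msqrt (X t z ** adj (X t z)) ** W z ** (X s z ** adj (X s z)) ** W z **
             msqrt (X t z ** adj (X t z)))) = of_real ((s - t)\<^sup>2 * r l)"
      if l: "l \<in> grid N" and z: "z = zeta N l" for l z
    proof -
      have "trace (W z ** (X s z ** adj (X s z)) + W z ** (X t z ** adj (X t z))
        - 2 *\<^sub>R msqrt (msqrt (X t z ** adj (X t z)) ** W z ** (X s z ** adj (X s z)) ** W z **
             msqrt (X t z ** adj (X t z)))) = trace (adj (X s z - X t z) ** W z ** (X s z - X t z))"
      proof (rule hellinger_summand)
        show "adj (W z) = W z"
          using W[OF l] by (simp add: hpd_def z)
        show "invertible (X t z)"
          unfolding X_def z by (rule invertible_segment[OF W[OF l] X\<^sub>0[OF l] M[OF l] t])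
        show "hpsd (adj (X t z) ** W z ** X s z)"
          unfolding X_def z by (rule hpsd_segment_pair[OF W[OF l] X\<^sub>0[OF l] M[OF l] s t])
      qed
      also have "X s z - X t z = (s - t) *\<^sub>R (X\<^sub>1 z - X\<^sub>0 z)"
        by (simp add: X_def algebra_simps)
      also have "trace (adj ((s - t) *\<^sub>R (X\<^sub>1 z - X\<^sub>0 z)) ** W z ** ((s - t) *\<^sub>R (X\<^sub>1 z - X\<^sub>0 z))) =
          (s - t) *\<^sub>R (s - t) *\<^sub>R trace (D z)"
        by (simp only: adj_scaleR scaleR_matrix_mult_left scaleR_matrix_mult_right trace_scaleR D_def)
      also have "\<dots> = of_real ((s - t)\<^sup>2 * r l)"
        using r[OF l] by (simp add: scaleR_conv_of_real power2_eq_square z)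
      finally show ?thesis .
    qed
    then show "complex_of_real ((\<bar>s - t\<bar> * \<delta>)\<^sup>2) = 1 / of_nat (\<Prod>i\<in>UNIV. N $ i) *
      (\<Sum>l\<in>grid N. trace (W (zeta N l) ** (X s (zeta N l) ** adj (X s (zeta N l)))
         + W (zeta N l) ** (X t (zeta N l) ** adj (X t (zeta N l)))
         - 2 *\<^sub>R msqrt (msqrt (X t (zeta N l) ** adj (X t (zeta N l))) ** W (zeta N l) **
             (X s (zeta N l) ** adj (X s (zeta N l))) ** W (zeta N l) **
             msqrt (X t (zeta N l) ** adj (X t (zeta N l))))))"
      by (simp add: power_mult_distrib \<delta>(2) mult_ac flip: sum_distrib_left sum_distrib_right)
  qed (simp add: \<delta>)
  then show ?thesis
    by blast
qed

text \<open>With \<open>S\<close> and \<open>T\<close> the roots of \<open>A\<close> and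
  \<open>B\<close>, the inverses in \<open>U\<close> cancel \<open>S ** W ** T\<close> and leave
  \<open>M\<close>. In \<open>U ** adj U\<close> the middle factor \<open>M ** M\<close> is
  \<open>S ** W ** T ** T ** W ** S\<close>, which cancels from both sides.\<close>

lemma optimal_alignment:
  fixes A B W :: "complex ^ 'm ^ 'm"
  assumes A: "hpd A" and B: "hpd B" and W: "hpd W"
  defines "M \<equiv> msqrt (msqrt A ** W ** B ** W ** msqrt A)"
  defines "U \<equiv> matrix_inv (msqrt B) ** matrix_inv W ** matrix_inv (msqrt A) ** M"
  shows "U ** adj U = mat 1" "msqrt A ** W ** (msqrt B ** U) = M" "hpd M"
    "hpsd (msqrt A ** W ** B ** W ** msqrt A)"
proof -
  define S T where "S = msqrt A" and "T = msqrt B"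
  have "hpd S" "hpd T" and TT: "T ** T = B"
    using A B by (simp_all add: S_def T_def msqrt_hpd hpd_imp_hpsd msqrt_mult_self)
  note inv = hpd_invertible[OF \<open>hpd S\<close>] hpd_invertible[OF \<open>hpd T\<close>] hpd_invertible[OF W]
  note L = inv[THEN matrix_inv_left] and R = inv[THEN matrix_inv_right]
  have sa: "adj S = S" "adj T = T" "adj W = W" "adj (matrix_inv S) = matrix_inv S"
    "adj (matrix_inv T) = matrix_inv T" "adj (matrix_inv W) = matrix_inv W"
    using \<open>hpd S\<close> \<open>hpd T\<close> W hpd_matrix_inv unfolding hpd_def by blast+
  \<comment> \<open>The matrix under the root is a congruence of \<open>B\<close> by
    \<open>W ** S\<close>; invertibility of the latter makes it, and so \<open>M\<close>, strictly
    positive.\<close>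
  have "invertible (W ** S)"
    using inv by (intro invertible_mult)
  from hpd_congruence[OF B this] have K: "hpd (S ** W ** B ** W ** S)"
    by (simp add: adj_mult sa matrix_mul_assoc)
  then show "hpsd (msqrt A ** W ** B ** W ** msqrt A)"
    by (simp add: hpd_imp_hpsd S_def)
  show "hpd M"
    using msqrt_hpd[OF K] by (simp add: M_def S_def)
  have MM: "M ** M = S ** W ** (T ** T) ** W ** S" and M: "adj M = M"
    using msqrt_mult_self[OF hpd_imp_hpsd[OF K]] \<open>hpd M\<close> by (simp_all add: M_def S_def TT hpd_def)
  have canc: "matrix_inv S ** (S ** C) = C" "S ** (matrix_inv S ** C) = C"
    "matrix_inv T ** (T ** C) = C" "T ** (matrix_inv T ** C) = C"
    "matrix_inv W ** (W ** C) = C" "W ** (matrix_inv W ** C) = C" for C :: "complex ^ 'm ^ 'm"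
    by (simp_all add: matrix_mul_assoc L R)
  have U: "U = matrix_inv T ** (matrix_inv W ** (matrix_inv S ** M))"
    by (simp add: U_def S_def T_def matrix_mul_assoc)
  have "U ** adj U = matrix_inv T ** (matrix_inv W ** (matrix_inv S **
      ((M ** M) ** (matrix_inv S ** (matrix_inv W ** matrix_inv T)))))"
    by (simp add: U adj_mult sa M matrix_mul_assoc)
  also have "\<dots> = mat 1"
    unfolding MM by (simp add: canc L R flip: matrix_mul_assoc)
  finally show "U ** adj U = mat 1" .
  show "msqrt A ** W ** (msqrt B ** U) = M"
    by (simp add: U canc flip: S_def T_def matrix_mul_assoc)
qed

theorem mainTheorem6:
  fixes N :: "nat ^ 'd"
    and \<Phi>\<^sub>0 \<Phi>\<^sub>1 \<Omega> H :: "complex ^ 'd \<Rightarrow> complex ^ 'm ^ 'm"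
    and C :: "int ^ 'd \<Rightarrow> real ^ 'm ^ 'm"
  assumes "\<And>i. N $ i \<ge> 1"
    and "pd_spectral_density N \<Phi>\<^sub>0"
    and "pd_spectral_density N \<Phi>\<^sub>1"
    and "\<And>l. l \<in> grid N \<Longrightarrow> H (zeta N l) = trig_matrix N C (zeta N l)"
    and "\<And>l. l \<in> grid N \<Longrightarrow> \<Omega> (zeta N l) = H (zeta N l) ** adj (H (zeta N l))"
    and "\<And>l. l \<in> grid N \<Longrightarrow> hpd (\<Omega> (zeta N l))"
  shows "all_pass N (U_weight \<Omega> \<Phi>\<^sub>0 \<Phi>\<^sub>1) \<and>
         hellinger_geodesic N \<Omega> \<Phi>\<^sub>0 \<Phi>\<^sub>1 (hellinger_path \<Omega> \<Phi>\<^sub>0 \<Phi>\<^sub>1)"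
proof -
  define U where "U = U_weight \<Omega> \<Phi>\<^sub>0 \<Phi>\<^sub>1"
  define P where "P = hellinger_path \<Omega> \<Phi>\<^sub>0 \<Phi>\<^sub>1"
  define X where "X = (\<lambda>t z. (1 - t) *\<^sub>R msqrt (\<Phi>\<^sub>0 z) + t *\<^sub>R (msqrt (\<Phi>\<^sub>1 z) ** U z))"
  have P: "P t z = X t z ** adj (X t z)" for t z
    by (simp add: P_def X_def U_def hellinger_path_def Let_def)
  have pd: "hpd (\<Phi>\<^sub>0 (zeta N l))" "hpd (\<Phi>\<^sub>1 (zeta N l))" "hpd (\<Omega> (zeta N l))"
    if "l \<in> grid N" for l
    using assms(2,3,6) that by (simp_all add: pd_spectral_density_def)
  have U: "U (zeta N l) = matrix_inv (msqrt (\<Phi>\<^sub>1 (zeta N l))) ** matrix_inv (\<Omega> (zeta N l)) **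
      matrix_inv (msqrt (\<Phi>\<^sub>0 (zeta N l))) ** msqrt (msqrt (\<Phi>\<^sub>0 (zeta N l)) ** \<Omega> (zeta N l) **
        \<Phi>\<^sub>1 (zeta N l) ** \<Omega> (zeta N l) ** msqrt (\<Phi>\<^sub>0 (zeta N l)))" for l
    by (simp only: U_def U_weight_def)
  have align: "U (zeta N l) ** adj (U (zeta N l)) = mat 1"
    "hpd (msqrt (\<Phi>\<^sub>0 (zeta N l)) ** \<Omega> (zeta N l) ** (msqrt (\<Phi>\<^sub>1 (zeta N l)) ** U (zeta N l)))"
    "hpsd (msqrt (\<Phi>\<^sub>0 (zeta N l)) ** \<Omega> (zeta N l) ** \<Phi>\<^sub>1 (zeta N l) ** \<Omega> (zeta N l) **
      msqrt (\<Phi>\<^sub>0 (zeta N l)))" if "l \<in> grid N" for l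
    using optimal_alignment[OF pd[OF that]] unfolding U by simp_all
  have inv: "invertible (msqrt (\<Phi>\<^sub>0 (zeta N l)))"
    and M: "hpd (adj (msqrt (\<Phi>\<^sub>0 (zeta N l))) ** \<Omega> (zeta N l) **
      (msqrt (\<Phi>\<^sub>1 (zeta N l)) ** U (zeta N l)))" if l: "l \<in> grid N" for l
  proof -
    have S: "hpd (msqrt (\<Phi>\<^sub>0 (zeta N l)))"
      by (rule msqrt_hpd[OF pd(1)[OF l]])
    then show "invertible (msqrt (\<Phi>\<^sub>0 (zeta N l)))"
      by (rule hpd_invertible)
    have "adj (msqrt (\<Phi>\<^sub>0 (zeta N l))) = msqrt (\<Phi>\<^sub>0 (zeta N l))"
      using S by (simp add: hpd_def)
    then show "hpd (adj (msqrt (\<Phi>\<^sub>0 (zeta N l))) ** \<Omega> (zeta N l) **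
        (msqrt (\<Phi>\<^sub>1 (zeta N l)) ** U (zeta N l)))"
      using align(2)[OF l] by simp
  qed
  \<comment> \<open>The reflection symmetry that yields real Fourier coefficients of the
    path.\<close>
  have cnj: "P t (vcnj (zeta N l)) = map_matrix cnj (P t (zeta N l))" if l: "l \<in> grid N" for t l
  proof -
    obtain k where k: "k \<in> grid N" "zeta N k = vcnj (zeta N l)"
      using vcnj_zeta_grid[OF l] by blast
    \<comment> \<open>A density is known to be a trigonometric sum only on the torus, so the
      reflected point is used as the grid point \<open>zeta N k\<close>.\<close>
    have \<Phi>: "\<Phi> (vcnj (zeta N l)) = map_matrix cnj (\<Phi> (zeta N l))"
      if "pd_spectral_density N \<Phi>" for \<Phi> :: "complex ^ 'd \<Rightarrow> complex ^ 'm ^ 'm"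
      using that k l unfolding pd_spectral_density_def by (metis trig_matrix_vcnj)
    have \<Omega>: "\<Omega> (vcnj (zeta N l)) = map_matrix cnj (\<Omega> (zeta N l))"
      using assms(4,5)[OF l] assms(4,5)[OF k(1)]
      by (simp add: k(2) trig_matrix_vcnj map_cnj_mult map_cnj_adj)
    note pd_l = pd[OF l] pd[OF l, THEN hpd_imp_hpsd]
    have "U (vcnj (zeta N l)) = map_matrix cnj (U (zeta N l))"
      using pd_l align(3)[OF l]
      by (simp add: U_def U_weight_def \<Phi>[OF assms(2)] \<Phi>[OF assms(3)] \<Omega> msqrt_map_cnj
          matrix_inv_map_cnj hpd_invertible msqrt_hpd flip: map_cnj_mult)
    then show ?thesis
      using pd_l by (simp add: P X_def \<Phi>[OF assms(2)] \<Phi>[OF assms(3)] msqrt_map_cnj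
          map_cnj_mult map_cnj_scaleR map_cnj_add map_cnj_adj)
  qed
  have "all_pass N U"
    unfolding all_pass_def using align(1) by blast
  moreover have "pd_spectral_density N (P t)" if "t \<in> {0..1}" for t
    unfolding pd_spectral_density_def
  proof
    show "\<exists>R. \<forall>l\<in>grid N. P t (zeta N l) = trig_matrix N R (zeta N l)"
      by (rule trig_matrix_if_cnj_symmetric[OF assms(1) cnj])
    show "\<forall>l\<in>grid N. hpd (P t (zeta N l))"
      unfolding P X_def using invertible_segment[OF pd(3) inv M that] hpd_mult_adj by blast
  qed
  moreover have ends: "P 0 (zeta N l) = \<Phi>\<^sub>0 (zeta N l)" "P 1 (zeta N l) = \<Phi>\<^sub>1 (zeta N l)"
    if l: "l \<in> grid N" for l
  proof -
    have adj: "adj (msqrt (\<Phi>\<^sub>0 (zeta N l))) = msqrt (\<Phi>\<^sub>0 (zeta N l))"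
        "adj (msqrt (\<Phi>\<^sub>1 (zeta N l))) = msqrt (\<Phi>\<^sub>1 (zeta N l))"
      using pd(1,2)[OF l] msqrt_hpd unfolding hpd_def by blast+
    show "P 0 (zeta N l) = \<Phi>\<^sub>0 (zeta N l)"
      by (simp add: P X_def adj msqrt_mult_self hpd_imp_hpsd pd(1)[OF l])
    let ?T = "msqrt (\<Phi>\<^sub>1 (zeta N l))"
    \<comment> \<open>The unitary factors meet in the middle and cancel, leaving the square of the
      root.\<close>
    have "P 1 (zeta N l) = ?T ** (U (zeta N l) ** adj (U (zeta N l))) ** ?T"
      by (simp add: P X_def adj adj_mult matrix_mul_assoc)
    then show "P 1 (zeta N l) = \<Phi>\<^sub>1 (zeta N l)"
      by (simp add: align(1)[OF l] msqrt_mult_self hpd_imp_hpsd pd(2)[OF l])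
  qed
  moreover obtain \<delta> where \<delta>: "\<And>s t. s \<in> {0..1} \<Longrightarrow> t \<in> {0..1} \<Longrightarrow>
      hellinger N \<Omega> (P s) (P t) = \<bar>s - t\<bar> * \<delta>"
    using hellinger_geodesic_segment[of N \<Omega> "\<lambda>z. msqrt (\<Phi>\<^sub>0 z)" "\<lambda>z. msqrt (\<Phi>\<^sub>1 z) ** U z",
        OF pd(3) inv M]
    unfolding P[abs_def] X_def by blast
  \<comment> \<open>The choice \<open>s = 0\<close>, \<open>t = 1\<close> identifies the speed with
    the distance of the endpoints.\<close>
  moreover have "hellinger N \<Omega> \<Phi>\<^sub>0 \<Phi>\<^sub>1 = \<delta>"
    using hellinger_cong[of N "P 0" \<Phi>\<^sub>0 "P 1" \<Phi>\<^sub>1 \<Omega>, OF ends] \<delta>[of 0 1] by simp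
  ultimately show ?thesis
    unfolding hellinger_geodesic_def P_def[symmetric] U_def[symmetric] by simp
qed

end
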